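(* Let $n\ge 2$. There exists a complete non-Kähler, conformal Kähler Hermitian metric on $\mathbb{C}^n$ whose (Chern) holomorphic sectional curvature is identically zero but whose Chern curvature tensor is nonvanishing (not identically zero).
   Context: For a Hermitian metric $\omega=\sqrt{-1}\,h_{i\bar j}dz^i\wedge d\bar z^j$, the Chern connection has Christoffel symbols $\Gamma_{ij}^k=h^{k\bar l}\partial_i h_{j\bar l}$ and curvature $R_{i\bar jk\bar l}=-h_{p\bar l}\,\partial_{\bar j}\Gamma^p_{ik}$. The holomorphic sectional curvature is $H(X)=R(X,\bar X,X,\bar X)/|X|^4$ for nonzero $X=X^i\frac{\partial}{\partial z^i}\in T^{1,0}_p$, where $R(X,\bar X,X,\bar X)=R_{i\bar jk\bar l}X^i\overline{X^j}X^k\overline{X^l}$ and $|X|^2=h_{i\bar j}X^i\overline{X^j}$. The metric is Kähler if $d\omega=0$, complete if the underlying Riemannian metric is complete, and conformal Kähler if $\omega=e^f\omega_0$ for a smooth real function $f$ and a Kähler metric $\omega_0$. *)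

theory Defs
  imports "HOL-Analysis.Analysis"
begin

text \<open>In finite dimension, a map is of class \<open>C\<^sup>k\<^sup>+\<^sup>1\<close> iff it is differentiable and all its
  directional derivatives are of class \<open>C\<^sup>k\<close>.\<close>

primrec class_C :: "nat \<Rightarrow> ('a::euclidean_space \<Rightarrow> 'b::real_normed_vector) \<Rightarrow> bool" where
  "class_C 0 f \<longleftrightarrow> continuous_on UNIV f"
| "class_C (Suc k) f \<longleftrightarrow>
     (\<forall>x. f differentiable (at x)) \<and> (\<forall>v. class_C k (\<lambda>x. frechet_derivative f (at x) v))"

definition smooth :: "('a::euclidean_space \<Rightarrow> 'b::real_normed_vector) \<Rightarrow> bool" where
  "smooth f \<longleftrightarrow> (\<forall>k. class_C k f)"

text \<open>Wirtinger derivatives with respect to the \<open>i\<close>-th coordinate \<open>z\<^sup>i\<close> of \<open>\<complex>\<^sup>n\<close>; the Frechet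
  derivative is the real-linear one.\<close>

definition d_hol :: "'n::finite \<Rightarrow> (complex^'n \<Rightarrow> complex) \<Rightarrow> complex^'n \<Rightarrow> complex" where
  "d_hol i f z =
     (frechet_derivative f (at z) (axis i 1) - \<i> * frechet_derivative f (at z) (axis i \<i>)) / 2"

definition d_antihol :: "'n::finite \<Rightarrow> (complex^'n \<Rightarrow> complex) \<Rightarrow> complex^'n \<Rightarrow> complex" where
  "d_antihol i f z =
     (frechet_derivative f (at z) (axis i 1) + \<i> * frechet_derivative f (at z) (axis i \<i>)) / 2"

text \<open>A Hermitian metric on \<open>\<complex>\<^sup>n\<close> is given by its coefficient matrix: \<open>h z $ i $ j\<close> is
  \<open>h\<close> with indices \<open>i\<close> and \<open>j\<close>-bar.  Tangent vectors, both real ones and those of type \<open>(1,0)\<close>, are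
  identified with elements of \<open>\<complex>\<^sup>n\<close> by \<open>X \<mapsto> \<Sum>\<^sub>i X\<^sup>i \<partial>/\<partial>z\<^sup>i\<close>; a real vector is twice the real part of its \<open>(1,0)\<close> representative.\<close>

definition herm :: "(complex^'n \<Rightarrow> complex^'n^'n) \<Rightarrow> complex^'n \<Rightarrow> complex^'n \<Rightarrow> complex^'n \<Rightarrow> complex"
  where "herm h z X Y = (\<Sum>i\<in>UNIV. \<Sum>j\<in>UNIV. h z $ i $ j * X $ i * cnj (Y $ j))"

definition hermitian_metric :: "(complex^'n::finite \<Rightarrow> complex^'n^'n) \<Rightarrow> bool" where
  "hermitian_metric h \<longleftrightarrow>
     (\<forall>i j. smooth (\<lambda>z. h z $ i $ j)) \<and>
     (\<forall>z i j. h z $ j $ i = cnj (h z $ i $ j)) \<and>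
     (\<forall>z X. X \<noteq> 0 \<longrightarrow> 0 < Re (herm h z X X))"

text \<open>The form \<open>\<omega> = \<i> h\<^sub>i\<^sub>j dz\<^sup>i \<and> dz\<^sup>j\<close> (second factor conjugated) evaluated on real tangent vectors.\<close>

definition fundamental_form ::
    "(complex^'n \<Rightarrow> complex^'n^'n) \<Rightarrow> complex^'n \<Rightarrow> complex^'n \<Rightarrow> complex^'n \<Rightarrow> complex" where
  "fundamental_form h z u v =
     \<i> * (\<Sum>i\<in>UNIV. \<Sum>j\<in>UNIV. h z $ i $ j * (u $ i * cnj (v $ j) - v $ i * cnj (u $ j)))"

text \<open>Exterior derivative of a 2-form on a vector space, evaluated on constant vector fields
  (so that the Lie bracket terms vanish).\<close>

definition ext_deriv2 ::
    "('a::real_normed_vector \<Rightarrow> 'a \<Rightarrow> 'a \<Rightarrow> complex) \<Rightarrow> 'a \<Rightarrow> 'a \<Rightarrow> 'a \<Rightarrow> 'a \<Rightarrow> complex" where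
  "ext_deriv2 \<omega> x u v w =
     frechet_derivative (\<lambda>y. \<omega> y v w) (at x) u
     - frechet_derivative (\<lambda>y. \<omega> y u w) (at x) v
     + frechet_derivative (\<lambda>y. \<omega> y u v) (at x) w"

definition kahler_metric :: "(complex^'n::finite \<Rightarrow> complex^'n^'n) \<Rightarrow> bool" where
  "kahler_metric h \<longleftrightarrow>
     hermitian_metric h \<and> (\<forall>z u v w. ext_deriv2 (fundamental_form h) z u v w = 0)"

definition conformal_kahler :: "(complex^'n::finite \<Rightarrow> complex^'n^'n) \<Rightarrow> bool" where
  "conformal_kahler h \<longleftrightarrow>
     (\<exists>(f :: complex^'n \<Rightarrow> real) h0. smooth f \<and> kahler_metric h0 \<and>
        (\<forall>z u v. fundamental_form h z u v = of_real (exp (f z)) * fundamental_form h0 z u v))"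

text \<open>The underlying Riemannian metric \<open>g(u,v) = \<omega>(u,Jv)\<close>, which for Hermitian \<open>h\<close> equals
  \<open>2 Re (h\<^sub>i\<^sub>j u\<^sup>i v\<^sup>j)\<close> with \<open>v\<close> conjugated.\<close>

definition riem_metric ::
    "(complex^'n \<Rightarrow> complex^'n^'n) \<Rightarrow> complex^'n \<Rightarrow> complex^'n \<Rightarrow> complex^'n \<Rightarrow> real" where
  "riem_metric h z u v = 2 * Re (herm h z u v)"

text \<open>The infimum is over lengths of piecewise \<open>C\<^sup>1\<close> curves.  The library's \<^const>\<open>valid_path\<close>
  allows the velocity to be unbounded near finitely many parameters; using \<open>has_integral\<close> rather than
  \<^const>\<open>integral\<close> leaves out curves of infinite length, whose \<^const>\<open>integral\<close> would be 0.\<close>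

definition riem_dist ::
    "(complex^'n::finite \<Rightarrow> complex^'n^'n) \<Rightarrow> complex^'n \<Rightarrow> complex^'n \<Rightarrow> real" where
  "riem_dist h x y = Inf {L. \<exists>\<gamma>. valid_path \<gamma> \<and> pathstart \<gamma> = x \<and> pathfinish \<gamma> = y \<and>
     ((\<lambda>t. sqrt (riem_metric h (\<gamma> t) (vector_derivative \<gamma> (at t)) (vector_derivative \<gamma> (at t))))
        has_integral L) {0..1}}"

text \<open>Every Cauchy sequence of the Riemannian distance converges in that distance.\<close>

definition complete_metric :: "(complex^'n::finite \<Rightarrow> complex^'n^'n) \<Rightarrow> bool" where
  "complete_metric h \<longleftrightarrow>
     (\<forall>\<sigma>. (\<forall>e>0. \<exists>N::nat. \<forall>m\<ge>N. \<forall>k\<ge>N. riem_dist h (\<sigma> m) (\<sigma> k) < e) \<longrightarrow>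
          (\<exists>l. (\<lambda>m. riem_dist h (\<sigma> m) l) \<longlonglongrightarrow> 0))"

text \<open>The inverse coefficients with indices \<open>k\<close>, \<open>l\<close>-bar are normalised by
  \<open>\<Sum>\<^sub>l h\<^sup>k\<^sup>l h\<^sub>j\<^sub>l = \<delta>\<^sup>k\<^sub>j\<close>; hence the transposed inverse matrix.
  \<open>chern_Gamma h z i j k\<close> has lower indices \<open>i\<close>, \<open>j\<close> and upper index \<open>k\<close>.\<close>

definition chern_Gamma ::
    "(complex^'n::finite \<Rightarrow> complex^'n^'n) \<Rightarrow> complex^'n \<Rightarrow> 'n \<Rightarrow> 'n \<Rightarrow> 'n \<Rightarrow> complex" where
  "chern_Gamma h z i j k =
     (\<Sum>l\<in>UNIV. matrix_inv (h z) $ l $ k * d_hol i (\<lambda>w. h w $ j $ l) z)"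

definition chern_curv ::
    "(complex^'n::finite \<Rightarrow> complex^'n^'n) \<Rightarrow> complex^'n \<Rightarrow> 'n \<Rightarrow> 'n \<Rightarrow> 'n \<Rightarrow> 'n \<Rightarrow> complex" where
  "chern_curv h z i j k l =
     - (\<Sum>p\<in>UNIV. h z $ p $ l * d_antihol j (\<lambda>w. chern_Gamma h w i k p) z)"

definition hol_sect_curv ::
    "(complex^'n::finite \<Rightarrow> complex^'n^'n) \<Rightarrow> complex^'n \<Rightarrow> complex^'n \<Rightarrow> complex" where
  "hol_sect_curv h z X =
     (\<Sum>i\<in>UNIV. \<Sum>j\<in>UNIV. \<Sum>k\<in>UNIV. \<Sum>l\<in>UNIV.
        chern_curv h z i j k l * X $ i * cnj (X $ j) * X $ k * cnj (X $ l)) / (herm h z X X)\<^sup>2"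

end

theory Submission
  imports Defs
begin

text \<open>
  The metric is \<open>h = (1 + |z|\<^sup>2)\<^sup>2 g\<close> with \<open>g\<close> the Fubini--Study metric in an affine chart, so
  \<open>h\<^sub>i\<^sub>j = (1 + |z|\<^sup>2) \<delta>\<^sub>i\<^sub>j - cnj z\<^sub>i z\<^sub>j\<close>.  By Cauchy--Schwarz it dominates the flat metric, which gives
  completeness.  The conformal factor cancels the constant holomorphic sectional curvature of \<open>g\<close>: the
  Christoffel symbols \<open>(cnj z\<^sub>i \<delta>\<^sub>j\<^sub>k - cnj z\<^sub>j \<delta>\<^sub>i\<^sub>k) / (1 + |z|\<^sup>2)\<close> are antisymmetric in their lower indices,
  hence so is the curvature in its two holomorphic slots, and \<open>R(X, cnj X, X, cnj X) = 0\<close>.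
\<close>

section \<open>Smooth functions\<close>

lemma frechet_derivative_eq:
  "(f has_derivative f') (at x) \<Longrightarrow> frechet_derivative f (at x) = f'"
  using frechet_derivative_at by metis

lemma class_C_const: "class_C k (\<lambda>x. c)"
proof (induction k arbitrary: c)
  case (Suc k)
  have "frechet_derivative (\<lambda>x. c) (at x) = (\<lambda>v. 0)" for x :: 'a
    by (rule frechet_derivative_eq) (rule has_derivative_const)
  then show ?case using Suc by simp
qed simp

text \<open>By uniqueness of the derivative, an explicitly given family \<open>D\<close> can replace
  the \<open>frechet_derivative\<close> in the recursion of \<open>class_C\<close>. The closure
  properties below are inductions on closed derivative formulas through this rule.\<close>

lemma class_C_SucI:
  assumes "\<And>x. (f has_derivative D x) (at x)" and "\<And>v. class_C k (\<lambda>x. D x v)"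
  shows "class_C (Suc k) f"
proof -
  have "f differentiable (at x)" for x
    using assms(1) unfolding differentiable_def by blast
  then show ?thesis by (simp add: assms(2) frechet_derivative_eq[OF assms(1)])
qed

lemma class_C_SucD:
  assumes "class_C (Suc k) f"
  obtains D where "\<And>x. (f has_derivative D x) (at x)" and "\<And>v. class_C k (\<lambda>x. D x v)"
proof
  show "(f has_derivative frechet_derivative f (at x)) (at x)" for x
    using assms by (simp add: frechet_derivative_works[symmetric])
  show "class_C k (\<lambda>x. frechet_derivative f (at x) v)" for v
    using assms by simp
qed

text \<open>Needed wherever a derivative formula still contains the undifferentiated function, as in
  the product rule. At order 0 it is the continuity of differentiable maps; at higher orders it is
  inherited from the directional derivatives.\<close>

lemma class_C_Suc_imp_class_C: "class_C (Suc k) f \<Longrightarrow> class_C k f"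
proof (induction k arbitrary: f)
  case 0
  then show ?case
    by (simp add: continuous_on_eq_continuous_at differentiable_imp_continuous_within)
next
  case (Suc k)
  obtain D where D: "\<And>x. (f has_derivative D x) (at x)" "\<And>v. class_C (Suc k) (\<lambda>x. D x v)"
    using class_C_SucD[OF Suc.prems] by blast
  show ?case by (rule class_C_SucI[OF D(1) Suc.IH[OF D(2)]])
qed

lemma class_C_bounded_linear:
  assumes "bounded_linear f"
  shows "class_C k f"
proof (cases k)
  case 0
  then show ?thesis using assms by (simp add: linear_continuous_on)
next
  case (Suc l)
  show ?thesis
    unfolding Suc by (rule class_C_SucI[OF bounded_linear_imp_has_derivative[OF assms] class_C_const])
qed

lemma class_C_bounded_linear_compose:
  assumes "bounded_linear L" and "class_C k f"
  shows "class_C k (\<lambda>x. L (f x))"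
  using assms(2)
proof (induction k arbitrary: f)
  case 0
  then show ?case using assms(1) by (simp add: bounded_linear.continuous_on)
next
  case (Suc k)
  obtain D where "\<And>x. (f has_derivative D x) (at x)" and "\<And>v. class_C k (\<lambda>x. D x v)"
    using class_C_SucD[OF Suc.prems] by blast
  then show ?case
    by (intro class_C_SucI[where D = "\<lambda>x v. L (D x v)"] bounded_linear.has_derivative[OF assms(1)]
        Suc.IH)
qed

lemma class_C_add:
  assumes "class_C k f" and "class_C k g"
  shows "class_C k (\<lambda>x. f x + g x)"
  using assms
proof (induction k arbitrary: f g)
  case 0
  then show ?case by (simp add: continuous_on_add)
next
  case (Suc k)
  obtain D E where "\<And>x. (f has_derivative D x) (at x)" "\<And>v. class_C k (\<lambda>x. D x v)"
      "\<And>x. (g has_derivative E x) (at x)" "\<And>v. class_C k (\<lambda>x. E x v)"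
    using class_C_SucD[OF Suc.prems(1)] class_C_SucD[OF Suc.prems(2)] by metis
  then show ?case
    by (intro class_C_SucI[where D = "\<lambda>x v. D x v + E x v"] has_derivative_add Suc.IH)
qed

lemma class_C_mult:
  fixes f g :: "'a::euclidean_space \<Rightarrow> 'b::real_normed_algebra"
  assumes "class_C k f" and "class_C k g"
  shows "class_C k (\<lambda>x. f x * g x)"
  using assms
proof (induction k arbitrary: f g)
  case 0
  then show ?case by (simp add: continuous_on_mult)
next
  case (Suc k)
  obtain D E where "\<And>x. (f has_derivative D x) (at x)" "\<And>v. class_C k (\<lambda>x. D x v)"
      "\<And>x. (g has_derivative E x) (at x)" "\<And>v. class_C k (\<lambda>x. E x v)"
    using class_C_SucD[OF Suc.prems(1)] class_C_SucD[OF Suc.prems(2)] by metis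
  then show ?case
    by (intro class_C_SucI[where D = "\<lambda>x v. f x * E x v + D x v * g x"] has_derivative_mult
        class_C_add Suc.IH class_C_Suc_imp_class_C[OF Suc.prems(1)] class_C_Suc_imp_class_C[OF Suc.prems(2)])
qed

text \<open>The derivative of \<open>inverse (f x)\<close> again contains
  \<open>inverse (f x)\<close>, but only one order less is required of it, so the induction
  hypothesis for the same \<open>f\<close> suffices.\<close>

lemma class_C_inverse:
  fixes f :: "'a::euclidean_space \<Rightarrow> 'b::real_normed_field"
  assumes "class_C k f" and "\<And>x. f x \<noteq> 0"
  shows "class_C k (\<lambda>x. inverse (f x))"
  using assms(1)
proof (induction k)
  case 0
  then show ?case using assms(2) by (simp add: continuous_on_inverse)
next
  case (Suc k)
  obtain D where D: "\<And>x. (f has_derivative D x) (at x)" "\<And>v. class_C k (\<lambda>x. D x v)"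
    using class_C_SucD[OF Suc.prems] by blast
  have "class_C k (\<lambda>x. inverse (f x))"
    by (rule Suc.IH[OF class_C_Suc_imp_class_C[OF Suc.prems]])
  \<comment> \<open>The sign is written as the constant factor -1, so that the product rule covers
    it.\<close>
  then have "class_C k (\<lambda>x. (-1) * (inverse (f x) * D x v * inverse (f x)))" for v
    by (intro class_C_mult class_C_const D)
  then have "class_C k (\<lambda>x. - (inverse (f x) * D x v * inverse (f x)))" for v
    by simp
  then show ?case
    by (intro class_C_SucI[where D = "\<lambda>x v. - (inverse (f x) * D x v * inverse (f x))"]
        Deriv.has_derivative_inverse assms(2) D)
qed

lemma class_C_ln:
  fixes f :: "'a::euclidean_space \<Rightarrow> real"
  assumes "class_C k f" and "\<And>x. f x > 0"
  shows "class_C k (\<lambda>x. ln (f x))"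
proof (cases k)
  case 0
  have "f x \<noteq> 0" for x using assms(2)[of x] by simp
  then show ?thesis using assms(1) 0 by (simp add: continuous_on_ln)
next
  case (Suc l)
  have f: "class_C (Suc l) f" using assms(1) Suc by (simp only:)
  obtain D where D: "\<And>x. (f has_derivative D x) (at x)" "\<And>v. class_C l (\<lambda>x. D x v)"
    using class_C_SucD[OF f] by blast
  have "f x \<noteq> 0" for x using assms(2)[of x] by simp
  then have "class_C l (\<lambda>x. D x v * inverse (f x))" for v
    by (intro class_C_mult D class_C_inverse class_C_Suc_imp_class_C[OF f])
  then show ?thesis unfolding Suc
    by (intro class_C_SucI[where D = "\<lambda>x v. D x v * inverse (f x)"]
        has_derivative_ln assms(2) D)
qed

lemma smooth_const: "smooth (\<lambda>x. c)"
  by (simp add: smooth_def class_C_const)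

lemma smooth_bounded_linear: "bounded_linear f \<Longrightarrow> smooth f"
  by (simp add: smooth_def class_C_bounded_linear)

lemma smooth_bounded_linear_compose:
  "bounded_linear L \<Longrightarrow> smooth f \<Longrightarrow> smooth (\<lambda>x. L (f x))"
  by (simp add: smooth_def class_C_bounded_linear_compose)

lemma smooth_add: "smooth f \<Longrightarrow> smooth g \<Longrightarrow> smooth (\<lambda>x. f x + g x)"
  by (simp add: smooth_def class_C_add)

lemma smooth_mult:
  fixes f g :: "'a::euclidean_space \<Rightarrow> 'b::real_normed_algebra"
  shows "smooth f \<Longrightarrow> smooth g \<Longrightarrow> smooth (\<lambda>x. f x * g x)"
  by (simp add: smooth_def class_C_mult)

lemma smooth_inverse:
  fixes f :: "'a::euclidean_space \<Rightarrow> 'b::real_normed_field"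
  shows "smooth f \<Longrightarrow> (\<And>x. f x \<noteq> 0) \<Longrightarrow> smooth (\<lambda>x. inverse (f x))"
  by (simp add: smooth_def class_C_inverse)

lemma smooth_ln:
  fixes f :: "'a::euclidean_space \<Rightarrow> real"
  shows "smooth f \<Longrightarrow> (\<And>x. f x > 0) \<Longrightarrow> smooth (\<lambda>x. ln (f x))"
  by (simp add: smooth_def class_C_ln)

lemma smooth_sum: "(\<And>i. i \<in> I \<Longrightarrow> smooth (f i)) \<Longrightarrow> smooth (\<lambda>x. \<Sum>i\<in>I. f i x)"
  by (induction I rule: infinite_finite_induct) (auto intro: smooth_const smooth_add)


section \<open>The metric\<close>

text \<open>The complex pairing keeps the imaginary part that the real inner product of
  \<open>complex^'n\<close> loses. Both metrics become rational expressions in it, so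
  differentiation and cancellation need no indices.\<close>

definition cinner :: "complex^'n \<Rightarrow> complex^'n \<Rightarrow> complex" where
  "cinner u v = (\<Sum>i\<in>UNIV. u $ i * cnj (v $ i))"

definition fs_weight :: "complex^'n \<Rightarrow> real" where
  "fs_weight z = 1 + (norm z)\<^sup>2"

definition scaled_fs :: "complex^'n::finite \<Rightarrow> complex^'n^'n" where
  "scaled_fs z = (\<chi> i j. (if i = j then of_real (fs_weight z) else 0) - cnj (z $ i) * z $ j)"

text \<open>This is the complex Hessian of \<open>ln (fs_weight z)\<close>, the usual potential of
  the Fubini--Study metric in an affine chart.\<close>

definition fubini_study :: "complex^'n::finite \<Rightarrow> complex^'n^'n" where
  "fubini_study z = (\<chi> i j. scaled_fs z $ i $ j / (of_real (fs_weight z))\<^sup>2)"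

section \<open>Index-free formulas for the metric and their derivatives\<close>

lemma fs_weight_pos: "fs_weight z > 0"
  by (simp add: fs_weight_def add_pos_nonneg)

lemma fs_weight_nonzero: "fs_weight z \<noteq> 0"
  using fs_weight_pos[of z] by simp

lemma cinner_self: "cinner z z = of_real ((norm z)\<^sup>2)"
proof -
  have "cinner z z = (\<Sum>i\<in>UNIV. of_real ((norm (z $ i))\<^sup>2))"
    by (simp only: cinner_def complex_norm_square)
  also have "\<dots> = of_real (\<Sum>i\<in>UNIV. (norm (z $ i))\<^sup>2)"
    by (simp only: of_real_sum)
  finally show ?thesis by (simp add: norm_vec_def L2_set_def sum_nonneg)
qed

lemma fs_weight_cinner: "of_real (fs_weight z) = 1 + cinner z z"
  by (simp add: fs_weight_def cinner_self)

lemma cnj_cinner: "cnj (cinner u v) = cinner v u"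
  by (simp add: cinner_def mult.commute)

lemma axis_component: "axis i c $ j = (if j = i then c else 0)"
  by (simp add: axis_def)

lemma cinner_zero_left [simp]: "cinner 0 v = 0" and cinner_zero_right [simp]: "cinner v 0 = 0"
  by (simp_all add: cinner_def)

lemma cinner_axis_left [simp]: "cinner (axis i c) w = c * cnj (w $ i)"
  by (simp add: cinner_def axis_component if_distrib[of "\<lambda>x. x * _"] cong: if_cong)

lemma cinner_axis_right [simp]: "cinner w (axis i c) = w $ i * cnj c"
  using cnj_cinner[of "axis i c" w] by (simp add: mult.commute)

lemma norm_cinner_le: "cmod (cinner u v) \<le> norm u * norm v"
proof -
  have "cmod (cinner u v) \<le> (\<Sum>i\<in>UNIV. cmod (u $ i * cnj (v $ i)))"
    unfolding cinner_def by (rule norm_sum)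
  also have "\<dots> = (\<Sum>i\<in>UNIV. \<bar>cmod (u $ i)\<bar> * \<bar>cmod (v $ i)\<bar>)"
    by (simp only: norm_mult complex_mod_cnj abs_norm_cancel)
  also have "\<dots> \<le> norm u * norm v"
    unfolding norm_vec_def by (rule L2_set_mult_ineq)
  finally show ?thesis .
qed

lemma has_derivative_cinner:
  assumes "(f has_derivative f') (at x within S)" and "(g has_derivative g') (at x within S)"
  shows "((\<lambda>x. cinner (f x) (g x)) has_derivative (\<lambda>d. cinner (f x) (g' d) + cinner (f' d) (g x)))
    (at x within S)"
  unfolding cinner_def sum.distrib[symmetric]
  by (intro has_derivative_sum has_derivative_mult
      bounded_linear.has_derivative[OF bounded_linear_vec_nth] assms
      bounded_linear.has_derivative[OF bounded_linear_compose[OF bounded_linear_cnj bounded_linear_vec_nth]])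

text \<open>The diagonal part of the matrix contributes the weight times the pairing; the rank-one
  part splits into a product of two sums.\<close>

lemma herm_scaled_fs:
  "herm scaled_fs z u v = (1 + cinner z z) * cinner u v - cinner u z * cinner z v"
proof -
  have "herm scaled_fs z u v =
    (\<Sum>i\<in>UNIV. \<Sum>j\<in>UNIV. (if i = j then (1 + cinner z z) * (u $ i * cnj (v $ j)) else 0)
       - (u $ i * cnj (z $ i)) * (z $ j * cnj (v $ j)))"
    unfolding herm_def scaled_fs_def
    by (intro sum.cong refl) (auto simp: fs_weight_cinner algebra_simps)
  also have "\<dots> = (\<Sum>i\<in>UNIV. (1 + cinner z z) * (u $ i * cnj (v $ i))) - cinner u z * cinner z v"
    unfolding cinner_def[of u z] cinner_def[of z v] sum_product sum_subtractf by simp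
  also have "(\<Sum>i\<in>UNIV. (1 + cinner z z) * (u $ i * cnj (v $ i))) = (1 + cinner z z) * cinner u v"
    unfolding cinner_def[of u v] by (rule sum_distrib_left[symmetric])
  finally show ?thesis .
qed

lemma has_derivative_one_plus_cinner: "((\<lambda>z. 1 + cinner z z) has_derivative (\<lambda>d. cinner z d + cinner d z)) (at z)"
  by (rule has_derivative_eq_rhs[OF has_derivative_add[OF has_derivative_const
      has_derivative_cinner[OF has_derivative_ident has_derivative_ident]]]) simp

lemma has_derivative_herm_scaled_fs:
  "((\<lambda>z. herm scaled_fs z u v) has_derivative
     (\<lambda>d. (cinner z d + cinner d z) * cinner u v - (cinner u z * cinner d v + cinner u d * cinner z v))) (at z)"
proof -
  have "(cinner u has_derivative cinner u) (at z)"
    by (rule has_derivative_eq_rhs[OF has_derivative_cinner[OF has_derivative_const has_derivative_ident]]) simp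
  moreover have "((\<lambda>z. cinner z v) has_derivative (\<lambda>d. cinner d v)) (at z)"
    by (rule has_derivative_eq_rhs[OF has_derivative_cinner[OF has_derivative_ident has_derivative_const]]) simp
  ultimately show ?thesis
    unfolding herm_scaled_fs
    by (intro has_derivative_diff has_derivative_mult_left has_derivative_one_plus_cinner has_derivative_mult)
qed

text \<open>Evaluating on basis vectors makes the derivative of each coefficient a special case of
  the index-free formula.\<close>

lemma scaled_fs_eq_herm: "scaled_fs z $ i $ j = herm scaled_fs z (axis i 1) (axis j 1)"
  by (simp add: herm_scaled_fs axis_component) (simp add: scaled_fs_def fs_weight_cinner)

lemma has_derivative_scaled_fs:
  "((\<lambda>z. scaled_fs z $ i $ j) has_derivative
     (\<lambda>d. (if i = j then cinner z d + cinner d z else 0) - (cnj (z $ i) * d $ j + cnj (d $ i) * z $ j))) (at z)"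
  unfolding scaled_fs_eq_herm
  by (rule has_derivative_eq_rhs[OF has_derivative_herm_scaled_fs]) (auto simp: axis_component)

lemma fundamental_form_eq_herm:
  "fundamental_form h z u v = \<i> * (herm h z u v - herm h z v u)"
  unfolding fundamental_form_def herm_def
  by (simp add: sum_subtractf[symmetric] algebra_simps)

lemma herm_fubini_study: "herm fubini_study z u v = herm scaled_fs z u v / (1 + cinner z z)\<^sup>2"
  by (simp add: herm_def fubini_study_def fs_weight_cinner sum_divide_distrib)

section \<open>Norm bounds, smoothness and positivity\<close>

lemma Re_herm_scaled_fs:
  "Re (herm scaled_fs z u u) = (1 + (norm z)\<^sup>2) * (norm u)\<^sup>2 - (cmod (cinner u z))\<^sup>2"
proof -
  have "herm scaled_fs z u u = of_real ((1 + (norm z)\<^sup>2) * (norm u)\<^sup>2 - (cmod (cinner u z))\<^sup>2)"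
    unfolding herm_scaled_fs cinner_self cnj_cinner[of u z, symmetric] complex_norm_square[symmetric]
    by (simp add: complex_norm_square[symmetric])
  then show ?thesis by simp
qed

text \<open>Cauchy--Schwarz absorbs the subtracted square into
  \<open>(norm z)\<^sup>2 * (norm u)\<^sup>2\<close>. The bound yields positivity here and the lower
  estimate of the distance later.\<close>

lemma Re_herm_scaled_fs_ge: "(norm u)\<^sup>2 \<le> Re (herm scaled_fs z u u)"
proof -
  have "(cmod (cinner u z))\<^sup>2 \<le> (norm u * norm z)\<^sup>2"
    by (intro power_mono norm_cinner_le) simp
  then show ?thesis by (simp add: Re_herm_scaled_fs algebra_simps power_mult_distrib)
qed

lemma Re_herm_scaled_fs_le: "Re (herm scaled_fs z u u) \<le> (1 + (norm z)\<^sup>2) * (norm u)\<^sup>2"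
  by (simp add: Re_herm_scaled_fs)

text \<open>The norm itself is not smooth at the origin; its square is a polynomial in the real
  coordinates.\<close>

lemma smooth_fs_weight: "smooth (fs_weight :: complex^'n::finite \<Rightarrow> real)"
proof -
  have "smooth (\<lambda>z :: complex^'n. 1 + (\<Sum>b\<in>Basis. (z \<bullet> b) * (z \<bullet> b)))"
    by (intro smooth_add smooth_sum smooth_mult smooth_const
        smooth_bounded_linear[OF bounded_linear_inner_left])
  moreover have "fs_weight = (\<lambda>z :: complex^'n. 1 + (\<Sum>b\<in>Basis. (z \<bullet> b) * (z \<bullet> b)))"
    by (simp add: fs_weight_def power2_norm_eq_inner euclidean_inner[symmetric] fun_eq_iff)
  ultimately show ?thesis by simp
qed

lemma smooth_scaled_fs: "smooth (\<lambda>z :: complex^'n::finite. scaled_fs z $ i $ j)"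
proof -
  have "smooth (\<lambda>z :: complex^'n. if i = j then complex_of_real (fs_weight z) else 0)"
    using smooth_bounded_linear_compose[OF bounded_linear_of_real smooth_fs_weight]
    by (cases "i = j") (simp_all add: smooth_const)
  then have "smooth (\<lambda>z :: complex^'n. (if i = j then of_real (fs_weight z) else 0)
      + (-1) * (cnj (z $ i) * z $ j))"
    by (intro smooth_add smooth_mult smooth_const
        smooth_bounded_linear[OF bounded_linear_vec_nth]
        smooth_bounded_linear[OF bounded_linear_compose[OF bounded_linear_cnj bounded_linear_vec_nth]])
  then show ?thesis by (simp add: scaled_fs_def)
qed

lemma smooth_fubini_study: "smooth (\<lambda>z :: complex^'n::finite. fubini_study z $ i $ j)"
proof -
  have "smooth (\<lambda>z :: complex^'n. inverse (complex_of_real (fs_weight z)))"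
    using smooth_bounded_linear_compose[OF bounded_linear_of_real smooth_fs_weight]
    by (intro smooth_inverse) (auto simp: fs_weight_nonzero)
  then have "smooth (\<lambda>z :: complex^'n. scaled_fs z $ i $ j *
      (inverse (of_real (fs_weight z)) * inverse (of_real (fs_weight z))))"
    by (intro smooth_mult smooth_scaled_fs)
  then show ?thesis
    by (simp add: fubini_study_def power2_eq_square divide_inverse)
qed

lemma hermitian_scaled_fs: "hermitian_metric scaled_fs"
  unfolding hermitian_metric_def
proof (intro conjI allI impI)
  fix z X :: "complex^'n" assume "X \<noteq> 0"
  then have "0 < (norm X)\<^sup>2" by simp
  then show "0 < Re (herm scaled_fs z X X)"
    using Re_herm_scaled_fs_ge less_le_trans by blast
qed (auto simp: smooth_scaled_fs, simp add: scaled_fs_def)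

lemma hermitian_fubini_study: "hermitian_metric fubini_study"
  unfolding hermitian_metric_def
proof (intro conjI allI impI)
  fix z X :: "complex^'n" assume "X \<noteq> 0"
  then have "0 < Re (herm scaled_fs z X X)"
    using hermitian_scaled_fs by (auto simp: hermitian_metric_def)
  moreover have "herm fubini_study z X X = herm scaled_fs z X X / of_real ((fs_weight z)\<^sup>2)"
    by (simp add: herm_fubini_study fs_weight_cinner)
  ultimately show "0 < Re (herm fubini_study z X X)"
    using fs_weight_nonzero[of z] by (simp add: Re_divide_of_real del: of_real_power)
qed (auto simp: smooth_fubini_study, simp add: fubini_study_def scaled_fs_def)

section \<open>Exterior derivatives and the conformal factor\<close>

lemma one_plus_cinner_nonzero: "1 + cinner z z \<noteq> 0"
  by (metis fs_weight_cinner fs_weight_nonzero of_real_eq_0_iff)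

lemma has_derivative_herm_fubini_study:
  "((\<lambda>z. herm fubini_study z u v) has_derivative
     (\<lambda>d. ((cinner z d + cinner d z) * cinner u v - (cinner u z * cinner d v + cinner u d * cinner z v)) / (1 + cinner z z)\<^sup>2
        - 2 * herm scaled_fs z u v * (cinner z d + cinner d z) / (1 + cinner z z) ^ 3)) (at z)"
proof -
  \<comment> \<open>Rewrites the output of the quotient rule for a squared denominator as separate
    fractions over the square and the cube.\<close>
  have quot: "(a * c\<^sup>2 - b * (c * e + e * c)) / (c\<^sup>2 * c\<^sup>2) = a / c\<^sup>2 - 2 * b * e / c ^ 3"
    if "c \<noteq> 0" for a b c e :: complex
    using that by (simp add: field_simps power2_eq_square power3_eq_cube)
  have "((\<lambda>z. (1 + cinner z z)\<^sup>2) has_derivative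
      (\<lambda>d. (1 + cinner z z) * (cinner z d + cinner d z) + (cinner z d + cinner d z) * (1 + cinner z z))) (at z)"
    unfolding power2_eq_square by (intro has_derivative_mult has_derivative_one_plus_cinner)
  then show ?thesis
    unfolding herm_fubini_study quot[OF one_plus_cinner_nonzero, symmetric]
    by (intro has_derivative_divide' has_derivative_herm_scaled_fs) (simp_all add: one_plus_cinner_nonzero)
qed

text \<open>Over the common denominator \<open>(1 + cinner z z) ^ 3\<close>, the alternating sum has
  as numerator a polynomial in the pairings of \<open>z\<close>, \<open>u\<close>, \<open>v\<close>,
  \<open>w\<close>, all of whose terms cancel.\<close>

lemma kahler_fubini_study: "kahler_metric fubini_study"
  unfolding kahler_metric_def
proof (intro conjI allI hermitian_fubini_study)
  fix z u v w :: "complex^'n"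
  have D: "frechet_derivative (\<lambda>y. fundamental_form fubini_study y a b) (at z) =
    (\<lambda>d. \<i> * ((((cinner z d + cinner d z) * cinner a b - (cinner a z * cinner d b + cinner a d * cinner z b)) / (1 + cinner z z)\<^sup>2
        - 2 * herm scaled_fs z a b * (cinner z d + cinner d z) / (1 + cinner z z) ^ 3)
      - (((cinner z d + cinner d z) * cinner b a - (cinner b z * cinner d a + cinner b d * cinner z a)) / (1 + cinner z z)\<^sup>2
        - 2 * herm scaled_fs z b a * (cinner z d + cinner d z) / (1 + cinner z z) ^ 3)))" for a b
    unfolding fundamental_form_eq_herm
    by (intro frechet_derivative_eq has_derivative_mult_right has_derivative_diff
        has_derivative_herm_fubini_study)
  have c: "x / (1 + cinner z z)\<^sup>2 = x * (1 + cinner z z) / (1 + cinner z z) ^ 3" for x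
    using one_plus_cinner_nonzero by (simp add: power2_eq_square power3_eq_cube)
  show "ext_deriv2 (fundamental_form fubini_study) z u v w = 0"
    unfolding ext_deriv2_def D herm_scaled_fs c
      add_divide_distrib[symmetric] diff_divide_distrib[symmetric]
      times_divide_eq_right times_divide_eq_left
    by (simp add: algebra_simps)
qed

lemma conformal_kahler_scaled_fs: "conformal_kahler scaled_fs"
  unfolding conformal_kahler_def
proof (intro exI conjI allI)
  \<comment> \<open>The factor \<open>(fs_weight z)\<^sup>2\<close> between the two metrics, written
    as an exponential.\<close>
  show "smooth (\<lambda>z :: complex^'n. 2 * ln (fs_weight z))"
    by (intro smooth_mult smooth_const smooth_ln smooth_fs_weight fs_weight_pos)
  fix z u v :: "complex^'n"
  have "exp (2 * ln (fs_weight z)) = (fs_weight z)\<^sup>2"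
    using fs_weight_pos[of z] by (simp add: exp_double)
  then show "fundamental_form scaled_fs z u v =
      of_real (exp (2 * ln (fs_weight z))) * fundamental_form fubini_study z u v"
    using fs_weight_nonzero[of z]
    by (simp add: fundamental_form_eq_herm herm_fubini_study fs_weight_cinner[symmetric]
        diff_divide_distrib[symmetric])
qed (rule kahler_fubini_study)

lemma obtain_two_indices:
  assumes "CARD('n::finite) \<ge> 2"
  obtains i j :: "'n::finite" where "i \<noteq> j"
  using assms card_le_Suc0_iff_eq[of "UNIV :: 'n set"] by force

text \<open>The differential of the conformal factor is nonzero off the origin, and in complex
  dimension at least 2 its wedge with a nondegenerate 2-form cannot vanish. A base point other than
  the origin is essential.\<close>

lemma not_kahler_scaled_fs:
  assumes "CARD('n::finite) \<ge> 2"
  shows "\<not> kahler_metric (scaled_fs :: complex^'n \<Rightarrow> _)"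
proof
  assume K: "kahler_metric (scaled_fs :: complex^'n \<Rightarrow> _)"
  obtain i j :: 'n where ij: "i \<noteq> j"
    using obtain_two_indices[OF assms] .
  define z :: "complex^'n" where "z = axis i 1"
  have D: "frechet_derivative (\<lambda>y. fundamental_form scaled_fs y a b) (at z) =
    (\<lambda>d. \<i> * (((cinner z d + cinner d z) * cinner a b - (cinner a z * cinner d b + cinner a d * cinner z b))
      - ((cinner z d + cinner d z) * cinner b a - (cinner b z * cinner d a + cinner b d * cinner z a))))" for a b
    unfolding fundamental_form_eq_herm
    by (intro frechet_derivative_eq has_derivative_mult_right has_derivative_diff
        has_derivative_herm_scaled_fs)
  \<comment> \<open>The radial direction is paired with the complex line of a second axis
    \<open>j\<close>. The radial derivative contributes 4 and the other two signed terms contribute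
    2 each.\<close>
  have "ext_deriv2 (fundamental_form scaled_fs) z z (axis j 1) (axis j \<i>) = 8"
    unfolding ext_deriv2_def D using ij
    by (simp add: z_def axis_component complex_eq_iff)
  then show False using K by (simp add: kahler_metric_def)
qed

section \<open>Completeness\<close>

lemma riem_metric_scaled_fs_ge: "norm u \<le> sqrt (riem_metric scaled_fs z u u)"
proof (rule real_le_rsqrt)
  have "0 \<le> (norm u)\<^sup>2" by simp
  then show "(norm u)\<^sup>2 \<le> riem_metric scaled_fs z u u"
    using Re_herm_scaled_fs_ge[of u z] unfolding riem_metric_def by linarith
qed

text \<open>The displacement is the integral of the velocity, whose norm is bounded pointwise by the
  length integrand.\<close>

lemma norm_diff_le_length:
  fixes \<gamma> :: "real \<Rightarrow> complex^'n::finite"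
  assumes "valid_path \<gamma>"
    and "((\<lambda>t. sqrt (riem_metric scaled_fs (\<gamma> t) (vector_derivative \<gamma> (at t)) (vector_derivative \<gamma> (at t))))
        has_integral L) {0..1}"
  shows "norm (pathfinish \<gamma> - pathstart \<gamma>) \<le> L"
proof -
  obtain S where S: "finite S" "\<gamma> C1_differentiable_on ({0..1} - S)" and cont: "continuous_on {0..1} \<gamma>"
    using assms(1) unfolding valid_path_def piecewise_C1_differentiable_on_def by blast
  have "(\<gamma> has_vector_derivative vector_derivative \<gamma> (at t)) (at t)" if "t \<in> {0<..<1} - S" for t
    using S(2) that by (simp add: C1_differentiable_on_eq vector_derivative_works[symmetric])
  \<comment> \<open>This form of the fundamental theorem asks for continuity and for a derivative
    off a finite set only, so an unbounded velocity of a \<open>valid_path\<close> does no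
    harm.\<close>
  then have "((\<lambda>t. vector_derivative \<gamma> (at t)) has_integral (\<gamma> 1 - \<gamma> 0)) {0..1}"
    using cont by (intro fundamental_theorem_of_calculus_interior_strong[OF S(1)]) simp_all
  then have "norm (\<gamma> 1 - \<gamma> 0) \<le> L \<bullet> 1"
    by (rule has_integral_norm_bound_integral_component[OF _ assms(2)])
      (simp add: riem_metric_scaled_fs_ge)
  then show ?thesis by (simp add: pathfinish_def pathstart_def)
qed

text \<open>In the constant, 2 comes from \<open>riem_metric\<close>, and
  \<open>1 + (max (norm x) (norm y))\<^sup>2\<close> bounds the weight along the segment, which
  stays in a ball about 0 by convexity.\<close>

lemma linepath_length_exists:
  fixes x y :: "complex^'n::finite"
  obtains L where "((\<lambda>t. sqrt (riem_metric scaled_fs (linepath x y t)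
        (vector_derivative (linepath x y) (at t)) (vector_derivative (linepath x y) (at t))))
        has_integral L) {0..1}"
    and "L \<le> sqrt (2 * (1 + (max (norm x) (norm y))\<^sup>2)) * norm (y - x)"
proof -
  define g where "g t = sqrt (riem_metric scaled_fs (linepath x y t) (y - x) (y - x))" for t
  have "continuous_on UNIV (\<lambda>z. herm scaled_fs z (y - x) (y - x))"
    by (intro continuous_at_imp_continuous_on ballI
        has_derivative_continuous[OF has_derivative_herm_scaled_fs])
  then have "continuous_on {0..1} (\<lambda>t. herm scaled_fs (linepath x y t) (y - x) (y - x))"
    by (rule continuous_on_compose2[OF _ continuous_on_linepath]) auto
  then have "continuous_on {0..1} g"
    unfolding g_def riem_metric_def by (intro continuous_intros)
  then have I: "(g has_integral integral {0..1} g) {0..1}"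
    by (intro integrable_integral integrable_continuous_real)
  have "integral {0..1} g \<le> sqrt (2 * (1 + (max (norm x) (norm y))\<^sup>2)) * norm (y - x)"
  proof -
    have "norm (integral {0..1} g)
      \<le> (sqrt (2 * (1 + (max (norm x) (norm y))\<^sup>2)) * norm (y - x)) * (1 - 0)"
    proof (rule integral_bound)
      fix t :: real assume t: "t \<in> {0..1}"
      have "norm (linepath x y t) \<le> max (norm x) (norm y)"
      proof -
        have "linepath x y t \<in> closed_segment x y" using t by (simp add: linepath_in_path)
        also have "\<dots> \<subseteq> cball 0 (max (norm x) (norm y))"
          by (intro closed_segment_subset convex_cball) auto
        finally show ?thesis by simp
      qed
      then have "(norm (linepath x y t))\<^sup>2 \<le> (max (norm x) (norm y))\<^sup>2"
        by (intro power_mono) auto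
      then have "(1 + (norm (linepath x y t))\<^sup>2) * (norm (y - x))\<^sup>2
          \<le> (1 + (max (norm x) (norm y))\<^sup>2) * (norm (y - x))\<^sup>2"
        by (intro mult_right_mono) auto
      with Re_herm_scaled_fs_le have "Re (herm scaled_fs (linepath x y t) (y - x) (y - x))
          \<le> (1 + (max (norm x) (norm y))\<^sup>2) * (norm (y - x))\<^sup>2"
        by (rule order_trans)
      then have "riem_metric scaled_fs (linepath x y t) (y - x) (y - x)
         \<le> 2 * (1 + (max (norm x) (norm y))\<^sup>2) * (norm (y - x))\<^sup>2"
        unfolding riem_metric_def mult.assoc by (rule mult_left_mono) simp
      then have "g t \<le> sqrt (2 * (1 + (max (norm x) (norm y))\<^sup>2) * (norm (y - x))\<^sup>2)"
        unfolding g_def by (rule real_sqrt_le_mono)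
      moreover have "0 \<le> g t"
        unfolding g_def by (rule order_trans[OF norm_ge_zero riem_metric_scaled_fs_ge])
      ultimately show "norm (g t) \<le> sqrt (2 * (1 + (max (norm x) (norm y))\<^sup>2)) * norm (y - x)"
        by (simp only: real_sqrt_mult real_sqrt_abs abs_norm_cancel real_norm_def)
    qed (use \<open>continuous_on {0..1} g\<close> in auto)
    then show ?thesis by simp
  qed
  with I show ?thesis by (intro that[of "integral {0..1} g"]) (simp_all add: g_def[abs_def])
qed

text \<open>The lower bound holds for every admissible curve. The segment gives the upper bound and
  also makes the set of lengths nonempty, so that its \<open>Inf\<close> is a genuine
  infimum.\<close>

lemma riem_dist_scaled_fs_bounds:
  fixes x y :: "complex^'n::finite"
  shows "norm (y - x) \<le> riem_dist scaled_fs x y"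
    and "riem_dist scaled_fs x y \<le> sqrt (2 * (1 + (max (norm x) (norm y))\<^sup>2)) * norm (y - x)"
proof -
  define A where "A = {L. \<exists>\<gamma>. valid_path \<gamma> \<and> pathstart \<gamma> = x \<and> pathfinish \<gamma> = y \<and>
     ((\<lambda>t. sqrt (riem_metric scaled_fs (\<gamma> t) (vector_derivative \<gamma> (at t)) (vector_derivative \<gamma> (at t))))
        has_integral L) {0..1}}"
  have lower: "norm (y - x) \<le> L" if "L \<in> A" for L
    using that norm_diff_le_length unfolding A_def by blast
  obtain L where "((\<lambda>t. sqrt (riem_metric scaled_fs (linepath x y t)
        (vector_derivative (linepath x y) (at t)) (vector_derivative (linepath x y) (at t))))
        has_integral L) {0..1}"
    and L_le: "L \<le> sqrt (2 * (1 + (max (norm x) (norm y))\<^sup>2)) * norm (y - x)"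
    by (rule linepath_length_exists)
  then have L: "L \<in> A"
    unfolding A_def by (intro CollectI exI[of _ "linepath x y"] conjI) simp_all
  have R: "riem_dist scaled_fs x y = Inf A" by (simp add: riem_dist_def A_def)
  show "norm (y - x) \<le> riem_dist scaled_fs x y"
    unfolding R using L lower by (intro cInf_greatest) auto
  have "Inf A \<le> L" using L lower by (intro cInf_lower bdd_belowI) auto
  then show "riem_dist scaled_fs x y \<le> sqrt (2 * (1 + (max (norm x) (norm y))\<^sup>2)) * norm (y - x)"
    unfolding R using L_le by simp
qed

text \<open>The lower bound makes a Cauchy sequence Cauchy in the Euclidean norm; the upper bound
  carries its Euclidean limit back to the Riemannian distance.\<close>

lemma complete_scaled_fs: "complete_metric (scaled_fs :: complex^'n::finite \<Rightarrow> _)"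
  unfolding complete_metric_def
proof (intro allI impI)
  fix \<sigma> :: "nat \<Rightarrow> complex^'n"
  assume C: "\<forall>e>0. \<exists>N::nat. \<forall>m\<ge>N. \<forall>k\<ge>N. riem_dist scaled_fs (\<sigma> m) (\<sigma> k) < e"
  have "dist (\<sigma> m) (\<sigma> k) \<le> riem_dist scaled_fs (\<sigma> m) (\<sigma> k)" for m k
    using riem_dist_scaled_fs_bounds(1) by (metis dist_commute dist_norm)
  with C have "Cauchy \<sigma>" unfolding Cauchy_def by (meson le_less_trans)
  then obtain l where l: "\<sigma> \<longlonglongrightarrow> l" using Cauchy_convergent convergent_def by blast
  \<comment> \<open>The factor depends on \<open>m\<close>, but it converges to a finite value
    because the norms converge, so the product tends to 0.\<close>
  have "(\<lambda>m. sqrt (2 * (1 + (max (norm (\<sigma> m)) (norm l))\<^sup>2)) * norm (l - \<sigma> m))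
      \<longlonglongrightarrow> sqrt (2 * (1 + (max (norm l) (norm l))\<^sup>2)) * norm (l - l)"
    by (intro tendsto_intros l)
  then have upper: "(\<lambda>m. sqrt (2 * (1 + (max (norm (\<sigma> m)) (norm l))\<^sup>2)) * norm (l - \<sigma> m))
      \<longlonglongrightarrow> 0"
    by simp
  have "0 \<le> riem_dist scaled_fs (\<sigma> m) l" for m
    by (rule order_trans[OF norm_ge_zero riem_dist_scaled_fs_bounds(1)])
  then have "(\<lambda>m. riem_dist scaled_fs (\<sigma> m) l) \<longlonglongrightarrow> 0"
    by (intro tendsto_sandwich[OF _ _ tendsto_const upper] always_eventually allI
        riem_dist_scaled_fs_bounds(2))
  then show "\<exists>l. (\<lambda>m. riem_dist scaled_fs (\<sigma> m) l) \<longlonglongrightarrow> 0" by blast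
qed

section \<open>Curvature\<close>

text \<open>\<open>matrix_inv\<close> is defined by choice; uniqueness of two-sided inverses
  identifies the chosen matrix.\<close>

lemma matrix_inv_eqI:
  fixes A B :: "'a::semiring_1^'n^'n"
  assumes "A ** B = mat 1" and "B ** A = mat 1"
  shows "matrix_inv A = B"
proof -
  have "A ** matrix_inv A = mat 1 \<and> matrix_inv A ** A = mat 1"
    unfolding matrix_inv_def by (rule someI[of _ B]) (use assms in auto)
  then show ?thesis
    by (metis assms(2) matrix_mul_assoc matrix_mul_lid matrix_mul_rid)
qed

text \<open>With \<open>c\<close> the weight and P the rank-one matrix with entries
  \<open>cnj (z $ i) * z $ j\<close>, one has P P = (c - 1) P, whence (c I - P)(I + P) = c
  I.\<close>

lemma matrix_inv_scaled_fs:
  fixes z :: "complex^'n::finite"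
  shows "matrix_inv (scaled_fs z) = (\<chi> i j. ((if i = j then 1 else 0) + cnj (z $ i) * z $ j) / of_real (fs_weight z))"
    (is "_ = ?B")
proof -
  let ?c = "complex_of_real (fs_weight z)"
  have nz: "?c \<noteq> 0" by (simp add: fs_weight_nonzero)
  have s: "(\<Sum>k\<in>UNIV. z $ k * cnj (z $ k)) = ?c - 1"
    by (simp add: fs_weight_cinner cinner_def)
  have s': "(\<Sum>k\<in>UNIV. cnj (z $ i) * z $ j * (z $ k * cnj (z $ k))) = cnj (z $ i) * z $ j * (?c - 1)" for i j
    by (simp add: s sum_distrib_left[symmetric])
  have d: "(\<Sum>k\<in>UNIV. (if i = k then a else 0) * f k) = a * f i"
    "(\<Sum>k\<in>UNIV. f k * (if k = i then a else 0)) = f i * a" for i :: 'n and a :: complex and f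
    by (simp_all add: if_distrib[of "\<lambda>x. x * _"] if_distrib[of "\<lambda>x. _ * x"] cong: if_cong)
  have 1: "scaled_fs z ** ?B = mat 1"
  proof -
    have "(\<Sum>k\<in>UNIV. scaled_fs z $ i $ k * ?B $ k $ j) = (if i = j then 1 else 0)" for i j
    proof -
      have "(\<Sum>k\<in>UNIV. scaled_fs z $ i $ k * ?B $ k $ j) =
        ((\<Sum>k\<in>UNIV. (if i = k then ?c else 0) * ((if k = j then 1 else 0) + cnj (z $ k) * z $ j))
         - (\<Sum>k\<in>UNIV. cnj (z $ i) * z $ k * (if k = j then 1 else 0))
         - (\<Sum>k\<in>UNIV. cnj (z $ i) * z $ j * (z $ k * cnj (z $ k)))) / ?c"
        unfolding sum_subtractf[symmetric] sum_divide_distrib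
        by (intro sum.cong refl) (simp add: scaled_fs_def algebra_simps diff_divide_distrib add_divide_distrib)
      also have "\<dots> = (if i = j then 1 else 0)"
        unfolding d s' using nz by (simp add: field_simps)
      finally show ?thesis .
    qed
    then show ?thesis by (simp add: matrix_matrix_mult_def mat_def)
  qed
  moreover have "?B ** scaled_fs z = mat 1"
    using 1 by (rule matrix_left_right_inverse1)
  ultimately show ?thesis by (rule matrix_inv_eqI)
qed

text \<open>The result is already antisymmetric in \<open>i\<close> and \<open>j\<close>, which is
  the source of the antisymmetry of the Christoffel symbols.\<close>

lemma d_hol_scaled_fs:
  "d_hol i (\<lambda>w. scaled_fs w $ j $ l) z = (if j = l then cnj (z $ i) else 0) - (if i = l then cnj (z $ j) else 0)"
  unfolding d_hol_def frechet_derivative_eq[OF has_derivative_scaled_fs]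
  by (simp add: axis_component algebra_simps)

lemma chern_Gamma_scaled_fs:
  "chern_Gamma scaled_fs z i j k =
     ((if j = k then cnj (z $ i) else 0) - (if i = k then cnj (z $ j) else 0)) / of_real (fs_weight z)"
proof -
  have "chern_Gamma scaled_fs z i j k = (\<Sum>l\<in>UNIV.
      ((if j = l then ((if l = k then 1 else 0) + cnj (z $ l) * z $ k) * cnj (z $ i) else 0)
     - (if i = l then ((if l = k then 1 else 0) + cnj (z $ l) * z $ k) * cnj (z $ j) else 0))
     / of_real (fs_weight z))"
    unfolding chern_Gamma_def matrix_inv_scaled_fs d_hol_scaled_fs
    by (intro sum.cong refl) (auto simp: field_simps)
  \<comment> \<open>The rank-one part of the inverse contributes
    \<open>cnj (z $ i) * cnj (z $ j) * z $ k\<close> twice with opposite signs.\<close>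
  also have "\<dots> = ((if j = k then cnj (z $ i) else 0) - (if i = k then cnj (z $ j) else 0))
     / of_real (fs_weight z)"
    unfolding sum_divide_distrib[symmetric] sum_subtractf by (simp add: algebra_simps)
  finally show ?thesis .
qed

lemma has_derivative_chern_Gamma_scaled_fs:
  fixes z :: "complex^'n::finite"
  shows "((\<lambda>w. chern_Gamma scaled_fs w i j k) has_derivative
     (\<lambda>d. (((if j = k then cnj (d $ i) else 0) - (if i = k then cnj (d $ j) else 0)) * (1 + cinner z z)
       - ((if j = k then cnj (z $ i) else 0) - (if i = k then cnj (z $ j) else 0)) * (cinner z d + cinner d z))
       / ((1 + cinner z z) * (1 + cinner z z)))) (at z)"
proof -
  have "((\<lambda>w. (if b then cnj (w $ m) else 0)) has_derivative (\<lambda>d. if b then cnj (d $ m) else 0)) (at z)"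
    for b and m :: 'n
    by (cases b) (auto intro!: bounded_linear_imp_has_derivative bounded_linear_vec_nth
        bounded_linear_compose[OF bounded_linear_cnj bounded_linear_vec_nth])
  then show ?thesis
    unfolding chern_Gamma_scaled_fs fs_weight_cinner
    by (intro has_derivative_divide' has_derivative_one_plus_cinner has_derivative_diff one_plus_cinner_nonzero)
qed

lemma chern_curv_scaled_fs_antisym:
  "chern_curv scaled_fs z k j i l = - chern_curv scaled_fs z i j k l"
proof -
  have "chern_Gamma scaled_fs w k i p = - chern_Gamma scaled_fs w i k p" for w :: "complex^'a" and p
    by (simp add: chern_Gamma_scaled_fs minus_divide_left)
  \<comment> \<open>Passing the sign through \<open>frechet_derivative\<close> relies on
    differentiability, supplied by the explicit derivative of the symbols.\<close>
  then have "frechet_derivative (\<lambda>w. chern_Gamma scaled_fs w k i p) (at z)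
      = (\<lambda>d. - frechet_derivative (\<lambda>w. chern_Gamma scaled_fs w i k p) (at z) d)" for p
    using has_derivative_minus[OF has_derivative_chern_Gamma_scaled_fs, of i k p z]
    by (simp only: frechet_derivative_eq frechet_derivative_eq[OF has_derivative_chern_Gamma_scaled_fs])
  then have "d_antihol j (\<lambda>w. chern_Gamma scaled_fs w k i p) z
      = - d_antihol j (\<lambda>w. chern_Gamma scaled_fs w i k p) z" for p
    by (simp add: d_antihol_def field_simps)
  then show ?thesis by (simp add: chern_curv_def sum_negf)
qed

text \<open>The curvature is antisymmetric in its two holomorphic slots while
  \<open>X $ i * X $ k\<close> is symmetric, so the numerator equals its own negative.\<close>

lemma hol_sect_curv_scaled_fs: "hol_sect_curv scaled_fs z X = 0"
proof -
  define F where "F i j k = (\<Sum>l\<in>UNIV.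
        chern_curv scaled_fs z i j k l * X $ i * cnj (X $ j) * X $ k * cnj (X $ l))" for i j k
  have F: "F k j i = - F i j k" for i j k
    unfolding F_def sum_negf[symmetric] chern_curv_scaled_fs_antisym[of z k j i]
    by (intro sum.cong refl) (simp add: algebra_simps)
  \<comment> \<open>Exchanging the two sums renames \<open>i\<close> and \<open>k\<close>, after
    which \<open>F\<close> applies termwise.\<close>
  have "(\<Sum>i\<in>UNIV. \<Sum>k\<in>UNIV. F i j k) = - (\<Sum>i\<in>UNIV. \<Sum>k\<in>UNIV. F i j k)" for j
    unfolding sum_negf[symmetric] by (subst sum.swap) (intro sum.cong refl F)
  then have "(\<Sum>i\<in>UNIV. \<Sum>k\<in>UNIV. F i j k) = 0" for j by simp
  then have "(\<Sum>i\<in>UNIV. \<Sum>j\<in>UNIV. \<Sum>k\<in>UNIV. F i j k) = 0"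
    by (subst sum.swap) simp
  then show ?thesis by (simp add: hol_sect_curv_def F_def)
qed

text \<open>At the origin the metric is the identity and the weight is stationary. The symbol
  involved is \<open>cnj (z $ i) / of_real (fs_weight z)\<close>, whose antiholomorphic
  \<open>i\<close>-derivative there is 1.\<close>

lemma chern_curv_scaled_fs_nonzero:
  fixes i k :: "'n::finite"
  assumes "i \<noteq> k"
  shows "chern_curv scaled_fs 0 i i k k = -1"
proof -
  have "scaled_fs 0 $ p $ k * c = (if p = k then c else 0)" for p and c :: complex
    by (simp add: scaled_fs_def fs_weight_def)
  then have "chern_curv scaled_fs 0 i i k k = - d_antihol i (\<lambda>w. chern_Gamma scaled_fs w i k k) 0"
    by (simp add: chern_curv_def)
  also have "\<dots> = -1"
    unfolding d_antihol_def frechet_derivative_eq[OF has_derivative_chern_Gamma_scaled_fs]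
    using assms by (simp add: axis_component)
  finally show ?thesis .
qed

theorem proposition1p6:
  assumes "CARD('n::finite) \<ge> 2"
  shows "\<exists>h :: complex^'n \<Rightarrow> complex^'n^'n.
           hermitian_metric h \<and>
           complete_metric h \<and>
           \<not> kahler_metric h \<and>
           conformal_kahler h \<and>
           (\<forall>z X. X \<noteq> 0 \<longrightarrow> hol_sect_curv h z X = 0) \<and>
           (\<exists>z i j k l. chern_curv h z i j k l \<noteq> 0)"
proof (intro exI[of _ scaled_fs] conjI)
  obtain i k :: 'n where "i \<noteq> k"
    using obtain_two_indices[OF assms] .
  then have "chern_curv scaled_fs 0 i i k k \<noteq> 0"
    by (simp add: chern_curv_scaled_fs_nonzero)
  then show "\<exists>(z :: complex^'n) i j k l. chern_curv scaled_fs z i j k l \<noteq> 0" by blast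
qed (use assms in \<open>auto simp: hermitian_scaled_fs complete_scaled_fs not_kahler_scaled_fs
      conformal_kahler_scaled_fs hol_sect_curv_scaled_fs\<close>)

end
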